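(* If $G$ is an autostackable group with inverse-closed generating set $X$, then $G$ has a rational cross-section.
   Context: For a set $X$, $X^*$ denotes the set of all finite strings over $X$, including the empty string $\varepsilon$. A group $G$ has a rational cross-section if, for some finite monoid generating set $X$ of $G$, there is a regular language $L\subseteq X^*$ such that each element of $G$ is represented by exactly one word of $L$. Let $G$ be a finitely generated group with a finite inverse-closed generating set $X$ (i.e. $x^{-1}\in X$ for all $x\in X$). The Cayley graph $\Gamma(G,X)$ is the directed graph with vertex set $G$ and, for each $g\in G$, $a\in X$, a directed edge $e_{g,a}$ from $g$ to $ga$ labelled $a$; let $\vec E$ be its edge set. A set of normal forms for $G$ over $X$ is a set $N\subseteq X^*$ such that each $g\in G$ is represented by a unique string $y_g\in N$. Given $N$, the edge $e_{g,a}$ is degenerate if there is an equality of strings $y_ga=y_{ga}$ or $y_g=y_{ga}a^{-1}$; $\vec E_{d}$ is the set of degenerate edges, and $\vec E_{r}=\vec E\setminus\vec E_{d}$ is the set of recursive edges. Let $\#\notin X$ be a padding symbol, $\widehat X=X\cup\{\#\}$ and $\overline X=\widehat X^3\setminus\{(\#,\#,\#)\}$. For $u,v,w\in X^*$, $(u,v,w)^t\in\overline X^*$ is the string obtained by padding $u,v,w$ on the right with $\#$ to the common length $\max(|u|,|v|,|w|)$ and reading the resulting three strings in parallel, letter by letter. A set $L\subseteq (X^* )^3$ is synchronously regular if $\{(u,v,w)^t\mid (u,v,w)\in L\}$ is a regular language over $\overline X$. $G$ is autostackable (with generating set $X$) if there are a set $N$ of normal forms for $G$ over $X$ containing $\varepsilon$,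 a constant $k$, and a function $\phi:N\times X\to X^*$ such that: (1) $\mathrm{graph}(\phi)=\{(y_g,x,\phi(y_g,x))\mid g\in G,x\in X\}$ is synchronously regular; (2) for each $g\in G$, $x\in X$, the word $\phi(y_g,x)$ has length at most $k$ and represents the element $x$ of $G$, and: (2d) if $e_{g,x}\in\vec E_d$ then $\phi(y_g,x)=x$ as words; (2r) the transitive closure of the relation $<$ on $\vec E_r$, defined by $e'<e_{g,x}$ whenever $e',e_{g,x}\in\vec E_r$ and $e'$ lies on the directed path in $\Gamma(G,X)$ labelled $\phi(y_g,x)$ starting at the vertex $g$, is a strict well-founded partial ordering. *)

theory Defs
  imports "HOL-Algebra.Generated_Groups"
begin

text \<open>Strings over a set \<open>X\<close> are lists with entries in \<open>X\<close>, and the set of all of them is \<^term>\<open>lists X\<close>.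
  A letter is literally an element of the group; the inverse of the letter \<open>a\<close> is its inverse in
  the group.\<close>

definition word_value :: "('a, 'b) monoid_scheme \<Rightarrow> 'a list \<Rightarrow> 'a" where
  "word_value G w = foldr (mult G) w (one G)"

text \<open>Regular means accepted by a complete deterministic finite automaton over a finite alphabet.
  Taking the states to be natural numbers loses no generality.\<close>

definition regular_language :: "'c set \<Rightarrow> 'c list set \<Rightarrow> bool" where
  "regular_language A L \<longleftrightarrow> finite A \<and>
    (\<exists>(Q :: nat set) q0 \<delta> F.
       finite Q \<and> q0 \<in> Q \<and> F \<subseteq> Q \<and> (\<forall>q\<in>Q. \<forall>a\<in>A. \<delta> q a \<in> Q) \<and>
       L = {w \<in> lists A. foldl \<delta> q0 w \<in> F})"

definition normal_forms :: "('a, 'b) monoid_scheme \<Rightarrow> 'a set \<Rightarrow> 'a list set \<Rightarrow> bool" where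
  "normal_forms G X N \<longleftrightarrow>
     N \<subseteq> lists X \<and> (\<forall>g\<in>carrier G. \<exists>!w. w \<in> N \<and> word_value G w = g)"

text \<open>The string \<open>y\<^sub>g\<close>; only meaningful when \<open>N\<close> is a set of normal forms and \<open>g\<close> lies in the
  carrier.\<close>

definition nf :: "('a, 'b) monoid_scheme \<Rightarrow> 'a list set \<Rightarrow> 'a \<Rightarrow> 'a list" where
  "nf G N g = (THE w. w \<in> N \<and> word_value G w = g)"

definition monoid_generating_set :: "('a, 'b) monoid_scheme \<Rightarrow> 'a set \<Rightarrow> bool" where
  "monoid_generating_set G X \<longleftrightarrow> X \<subseteq> carrier G \<and> word_value G ` lists X = carrier G"

definition has_rational_cross_section :: "('a, 'b) monoid_scheme \<Rightarrow> bool" where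
  "has_rational_cross_section G \<longleftrightarrow>
     (\<exists>X L. finite X \<and> monoid_generating_set G X \<and>
            L \<subseteq> lists X \<and> regular_language X L \<and>
            (\<forall>g\<in>carrier G. \<exists>!w. w \<in> L \<and> word_value G w = g))"

text \<open>The edge of the Cayley graph from \<open>g\<close> to \<open>g \<otimes> a\<close> labelled \<open>a\<close> is encoded as \<open>(g, a)\<close>.\<close>

definition cayley_edges :: "('a, 'b) monoid_scheme \<Rightarrow> 'a set \<Rightarrow> ('a \<times> 'a) set" where
  "cayley_edges G X = carrier G \<times> X"

definition degenerate_edges ::
    "('a, 'b) monoid_scheme \<Rightarrow> 'a set \<Rightarrow> 'a list set \<Rightarrow> ('a \<times> 'a) set" where
  "degenerate_edges G X N = {(g, a) \<in> cayley_edges G X.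
     nf G N g @ [a] = nf G N (g \<otimes>\<^bsub>G\<^esub> a) \<or>
     nf G N g = nf G N (g \<otimes>\<^bsub>G\<^esub> a) @ [inv\<^bsub>G\<^esub> a]}"

definition recursive_edges ::
    "('a, 'b) monoid_scheme \<Rightarrow> 'a set \<Rightarrow> 'a list set \<Rightarrow> ('a \<times> 'a) set" where
  "recursive_edges G X N = cayley_edges G X - degenerate_edges G X N"

fun path_edges :: "('a, 'b) monoid_scheme \<Rightarrow> 'a \<Rightarrow> 'a list \<Rightarrow> ('a \<times> 'a) set" where
  "path_edges G g [] = {}"
| "path_edges G g (a # w) = insert (g, a) (path_edges G (g \<otimes>\<^bsub>G\<^esub> a) w)"

text \<open>\<^term>\<open>None\<close> is the padding symbol.\<close>

definition padded_letter :: "'a list \<Rightarrow> nat \<Rightarrow> 'a option" where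
  "padded_letter w i = (if i < length w then Some (w ! i) else None)"

definition pad3 :: "'a list \<times> 'a list \<times> 'a list \<Rightarrow> ('a option \<times> 'a option \<times> 'a option) list" where
  "pad3 = (\<lambda>(u, v, w). map (\<lambda>i. (padded_letter u i, padded_letter v i, padded_letter w i))
                          [0..<max (length u) (max (length v) (length w))])"

definition padded_alphabet :: "'a set \<Rightarrow> ('a option \<times> 'a option \<times> 'a option) set" where
  "padded_alphabet X =
     (let Y = insert None (Some ` X) in Y \<times> Y \<times> Y - {(None, None, None)})"

definition synchronously_regular ::
    "'a set \<Rightarrow> ('a list \<times> 'a list \<times> 'a list) set \<Rightarrow> bool" where
  "synchronously_regular X L \<longleftrightarrow>
     L \<subseteq> lists X \<times> lists X \<times> lists X \<and> regular_language (padded_alphabet X) (pad3 ` L)"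

definition stacking_graph :: "('a, 'b) monoid_scheme \<Rightarrow> 'a set \<Rightarrow> 'a list set \<Rightarrow>
    ('a list \<times> 'a \<Rightarrow> 'a list) \<Rightarrow> ('a list \<times> 'a list \<times> 'a list) set" where
  "stacking_graph G X N \<phi> =
     {(nf G N g, [x], \<phi> (nf G N g, x)) | g x. g \<in> carrier G \<and> x \<in> X}"

text \<open>A pair \<open>(e', e)\<close> in this relation means \<open>e' < e\<close>.\<close>

definition stacking_less :: "('a, 'b) monoid_scheme \<Rightarrow> 'a set \<Rightarrow> 'a list set \<Rightarrow>
    ('a list \<times> 'a \<Rightarrow> 'a list) \<Rightarrow> (('a \<times> 'a) \<times> ('a \<times> 'a)) set" where
  "stacking_less G X N \<phi> =
     {(e', (g, x)) | e' g x.
        e' \<in> recursive_edges G X N \<and> (g, x) \<in> recursive_edges G X N \<and>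
        e' \<in> path_edges G g (\<phi> (nf G N g, x))}"

definition autostackable :: "('a, 'b) monoid_scheme \<Rightarrow> 'a set \<Rightarrow> bool" where
  "autostackable G X \<longleftrightarrow>
     (\<exists>N (k :: nat) \<phi>.
        normal_forms G X N \<and> [] \<in> N \<and> \<phi> \<in> N \<times> X \<rightarrow> lists X \<and>
        synchronously_regular X (stacking_graph G X N \<phi>) \<and>
        (\<forall>g\<in>carrier G. \<forall>x\<in>X.
           length (\<phi> (nf G N g, x)) \<le> k \<and>
           word_value G (\<phi> (nf G N g, x)) = x \<and>
           ((g, x) \<in> degenerate_edges G X N \<longrightarrow> \<phi> (nf G N g, x) = [x])) \<and>
        irrefl ((stacking_less G X N \<phi>)\<^sup>+) \<and> trans ((stacking_less G X N \<phi>)\<^sup>+) \<and>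
        wf ((stacking_less G X N \<phi>)\<^sup>+))"

end

theory Submission
  imports Defs
begin

text \<open>The cross-section is the set \<open>N\<close> of normal forms itself. Whenever \<open>X\<close> has a letter \<open>x\<close>, every
  normal form \<open>y\<^sub>g\<close> occurs as the first entry of a triple \<open>(y\<^sub>g, x, \<phi>(y\<^sub>g, x))\<close> of the graph of \<open>\<phi>\<close>,
  so \<open>N\<close> is the projection of that graph to its first coordinate, and the projection of a
  synchronously regular relation is regular (\<open>synchronously_regular_fst\<close>).

  Projecting to a track of a padded word makes an automaton nondeterministic, since the erased tracks
  have to be guessed; the subset construction repairs this. It also leaves padding symbols at the end,
  because another entry of the triple may be longer than the first; these are absorbed into the
  acceptance condition: a state is made accepting if some word whose first track is pure padding leads
  from it to acceptance (\<open>regular_language_padded_projection\<close>).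

  If \<open>X\<close> is empty the graph is empty and says nothing about \<open>N\<close>, but then \<open>N\<close> can only be
  \<open>{\<epsilon>}\<close>.\<close>

text \<open>The subset construction yields automata whose states are sets, so automata over an arbitrary
  state type are needed; their finitely many states can be renamed to natural numbers.\<close>

lemma regular_languageI:
  fixes Q :: "'s set" and A :: "'c set"
  assumes "finite A" and "finite Q" and "q0 \<in> Q"
    and closed: "\<And>q a. q \<in> Q \<Longrightarrow> a \<in> A \<Longrightarrow> \<delta> q a \<in> Q"
  shows "regular_language A {w \<in> lists A. foldl \<delta> q0 w \<in> F}"
proof -
  obtain f :: "'s \<Rightarrow> nat" where f: "inj_on f Q"
    using finite_imp_inj_to_nat_seg[OF \<open>finite Q\<close>] by blast
  define \<delta>' where "\<delta>' = (\<lambda>n a. f (\<delta> (inv_into Q f n) a))"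
  have run: "foldl \<delta>' (f q) w = f (foldl \<delta> q w) \<and> foldl \<delta> q w \<in> Q"
    if "w \<in> lists A" "q \<in> Q" for w q
    using that
  proof (induction w arbitrary: q)
    case (Cons a w)
    then show ?case using closed f by (simp add: \<delta>'_def)
  qed simp
  have "{w \<in> lists A. foldl \<delta> q0 w \<in> F} = {w \<in> lists A. foldl \<delta>' (f q0) w \<in> f ` (F \<inter> Q)}"
  proof (rule Collect_cong, rule conj_cong[OF refl])
    fix w assume "w \<in> lists A"
    then show "foldl \<delta> q0 w \<in> F \<longleftrightarrow> foldl \<delta>' (f q0) w \<in> f ` (F \<inter> Q)"
      using run[of w q0] \<open>q0 \<in> Q\<close> f by (auto simp: inj_on_eq_iff)
  qed
  moreover have "\<delta>' n a \<in> f ` Q" if "n \<in> f ` Q" "a \<in> A" for n a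
    using that closed f by (auto simp: \<delta>'_def)
  ultimately show ?thesis
    unfolding regular_language_def
    using \<open>finite A\<close> \<open>finite Q\<close> \<open>q0 \<in> Q\<close>
    by (intro conjI exI[of _ "f ` Q"] exI[of _ "f q0"] exI[of _ \<delta>'] exI[of _ "f ` (F \<inter> Q)"]) auto
qed

text \<open>Here \<open>h\<close> reads off one track of a padded word. The states of the new automaton are the sets of
  states that the old one can reach while the visible track spells out the input read so far. After the
  input the old automaton may still run through letters with invisible track, and the accepting sets
  are those from which such a continuation can succeed.\<close>

lemma regular_language_padded_projection:
  fixes h :: "'c \<Rightarrow> 'd option"
  assumes "regular_language A L" and "finite B"
  shows "regular_language B {u \<in> lists B. \<exists>p\<in>L. \<exists>m. map h p = map Some u @ replicate m None}"
proof -
  obtain Q :: "nat set" and q0 \<delta> F where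
    Q: "finite Q" "q0 \<in> Q" "\<And>q a. q \<in> Q \<Longrightarrow> a \<in> A \<Longrightarrow> \<delta> q a \<in> Q"
    and L: "L = {w \<in> lists A. foldl \<delta> q0 w \<in> F}"
    using assms(1) unfolding regular_language_def by blast
  define \<Delta> where "\<Delta> = (\<lambda>T b. {\<delta> q a | q a. q \<in> T \<and> a \<in> A \<and> h a = Some b})"
  define \<F> where "\<F> = {T. \<exists>q\<in>T. \<exists>p\<in>lists A. \<exists>m. map h p = replicate m None \<and> foldl \<delta> q p \<in> F}"
  have run: "foldl \<Delta> T u = {foldl \<delta> q p | q p. q \<in> T \<and> p \<in> lists A \<and> map h p = map Some u}" for T u
  proof (induction u arbitrary: T)
    case (Cons b u)
    show ?case
    proof (rule subset_antisym; rule subsetI)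
      fix s assume "s \<in> foldl \<Delta> T (b # u)"
      then have "s \<in> {foldl \<delta> q p | q p. q \<in> \<Delta> T b \<and> p \<in> lists A \<and> map h p = map Some u}"
        by (simp only: foldl_Cons Cons.IH)
      then obtain q a p where "s = foldl \<delta> q (a # p)" "q \<in> T" "a \<in> A" "p \<in> lists A"
          "h a = Some b" "map h p = map Some u"
        unfolding \<Delta>_def by auto
      then show "s \<in> {foldl \<delta> q p | q p. q \<in> T \<and> p \<in> lists A \<and> map h p = map Some (b # u)}"
        by (intro CollectI exI[of _ q] exI[of _ "a # p"]) simp
    next
      fix s assume "s \<in> {foldl \<delta> q p | q p. q \<in> T \<and> p \<in> lists A \<and> map h p = map Some (b # u)}"
      then obtain q r where r: "s = foldl \<delta> q r" "q \<in> T" "r \<in> lists A" "map h r = map Some (b # u)"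
        by blast
      then obtain a p where "r = a # p" by (cases r) auto
      with r have s: "s = foldl \<delta> (\<delta> q a) p" and "q \<in> T" "a \<in> A" "h a = Some b"
          and p: "p \<in> lists A" "map h p = map Some u"
        by simp_all
      then have "\<delta> q a \<in> \<Delta> T b" unfolding \<Delta>_def by blast
      with s p show "s \<in> foldl \<Delta> T (b # u)"
        unfolding foldl_Cons Cons.IH by blast
    qed
  qed auto
  have "(\<exists>p\<in>L. \<exists>m. map h p = map Some u @ replicate m None) \<longleftrightarrow> foldl \<Delta> {q0} u \<in> \<F>" for u
  proof
    assume "\<exists>p\<in>L. \<exists>m. map h p = map Some u @ replicate m None"
    then obtain p r m where "p @ r \<in> L" "map h p = map Some u" "map h r = replicate m None"
      by (metis map_eq_append_conv)
    then show "foldl \<Delta> {q0} u \<in> \<F>"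
      unfolding run \<F>_def L by auto
  next
    assume "foldl \<Delta> {q0} u \<in> \<F>"
    then obtain p r m where "p \<in> lists A" "map h p = map Some u"
        "r \<in> lists A" "map h r = replicate m None" "foldl \<delta> (foldl \<delta> q0 p) r \<in> F"
      unfolding run \<F>_def by auto
    then show "\<exists>p\<in>L. \<exists>m. map h p = map Some u @ replicate m None"
      unfolding L by (intro bexI[of _ "p @ r"] exI[of _ m]) auto
  qed
  moreover have "regular_language B {u \<in> lists B. foldl \<Delta> {q0} u \<in> \<F>}"
    by (rule regular_languageI[where Q = "Pow Q"]) (use Q assms(2) in \<open>auto simp: \<Delta>_def\<close>)
  ultimately show ?thesis by simp
qed

lemma map_fst_pad3:
  "\<exists>m. map fst (pad3 (u, v, w)) = map Some u @ replicate m None"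
proof -
  define n where "n = max (length u) (max (length v) (length w))"
  have "map fst (pad3 (u, v, w)) = map Some u @ replicate (n - length u) None"
    by (rule nth_equalityI)
      (auto simp: pad3_def padded_letter_def nth_append simp flip: n_def, auto simp: n_def)
  then show ?thesis by blast
qed

lemma map_Some_append_replicate_None_inject:
  "map Some u @ replicate m None = map Some v @ replicate n None \<Longrightarrow> u = v"
proof (induction u arbitrary: v)
  case Nil
  then show ?case by (cases v; cases m) auto
next
  case (Cons a u)
  then show ?case by (cases v; cases n) auto
qed

lemma finite_padded_alphabetD:
  assumes "finite (padded_alphabet X)"
  shows "finite X"
proof (rule inj_on_finite[OF _ _ assms])
  show "inj_on (\<lambda>x. (Some x, None, None)) X" by (auto simp: inj_on_def)
qed (auto simp: padded_alphabet_def)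

lemma synchronously_regular_fst:
  assumes "synchronously_regular X S"
  shows "regular_language X (fst ` S)"
proof -
  have S: "S \<subseteq> lists X \<times> lists X \<times> lists X"
    and reg: "regular_language (padded_alphabet X) (pad3 ` S)"
    using assms by (auto simp: synchronously_regular_def)
  have "finite X"
    using reg finite_padded_alphabetD by (auto simp: regular_language_def)
  have "u \<in> fst ` S \<longleftrightarrow>
      u \<in> lists X \<and> (\<exists>p\<in>pad3 ` S. \<exists>m. map fst p = map Some u @ replicate m None)" for u
  proof
    assume "u \<in> fst ` S"
    then obtain v w where "(u, v, w) \<in> S" by auto
    then show "u \<in> lists X \<and> (\<exists>p\<in>pad3 ` S. \<exists>m. map fst p = map Some u @ replicate m None)"
      using S map_fst_pad3[of u v w] by auto
  next
    assume "u \<in> lists X \<and> (\<exists>p\<in>pad3 ` S. \<exists>m. map fst p = map Some u @ replicate m None)"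
    then obtain u' v w m where
      "(u', v, w) \<in> S" "map fst (pad3 (u', v, w)) = map Some u @ replicate m None"
      by auto
    then show "u \<in> fst ` S"
      using map_fst_pad3[of u' v w] map_Some_append_replicate_None_inject by force
  qed
  then have "fst ` S =
      {u \<in> lists X. \<exists>p\<in>pad3 ` S. \<exists>m. map fst p = map Some u @ replicate m None}"
    by blast
  then show ?thesis
    using regular_language_padded_projection[OF reg \<open>finite X\<close>, of fst] by simp
qed

lemma (in monoid) word_value_closed:
  "w \<in> lists (carrier G) \<Longrightarrow> word_value G w \<in> carrier G"
  by (induction w) (auto simp: word_value_def)

lemma (in monoid) image_nf_carrier:
  assumes "normal_forms G X N" and "X \<subseteq> carrier G"
  shows "nf G N ` carrier G = N"
proof -
  have N: "N \<subseteq> lists X" and ex1: "\<And>g. g \<in> carrier G \<Longrightarrow> \<exists>!w. w \<in> N \<and> word_value G w = g"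
    using assms(1) by (auto simp: normal_forms_def)
  have "nf G N g \<in> N" if "g \<in> carrier G" for g
    using theI'[OF ex1[OF that]] by (simp add: nf_def)
  moreover have "word_value G w \<in> carrier G" "nf G N (word_value G w) = w" if "w \<in> N" for w
  proof -
    show *: "word_value G w \<in> carrier G"
      using that N assms(2) by (intro word_value_closed) auto
    show "nf G N (word_value G w) = w"
      unfolding nf_def using that by (intro the1_equality[OF ex1[OF *]]) simp
  qed
  ultimately show ?thesis by force
qed

lemma (in monoid) monoid_generating_set_if_normal_forms:
  assumes "normal_forms G X N" and "X \<subseteq> carrier G"
  shows "monoid_generating_set G X"
proof -
  have "word_value G w \<in> carrier G" if "w \<in> lists X" for w
    using that assms(2) by (intro word_value_closed) auto
  moreover have "g \<in> word_value G ` lists X" if "g \<in> carrier G" for g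
    using that assms(1) unfolding normal_forms_def by blast
  ultimately show ?thesis
    using assms(2) by (auto simp: monoid_generating_set_def)
qed

theorem theorem5p7:
  fixes G :: "('a, 'b) monoid_scheme" and X :: "'a set"
  assumes "group G"
    and "finite X" and "X \<subseteq> carrier G" and "generate G X = carrier G"
    and "\<And>x. x \<in> X \<Longrightarrow> inv\<^bsub>G\<^esub> x \<in> X"
    and "autostackable G X"
  shows "has_rational_cross_section G"
proof -
  interpret group G by fact
  obtain N \<phi> where nfs: "normal_forms G X N" and "[] \<in> N"
    and sync: "synchronously_regular X (stacking_graph G X N \<phi>)"
    using \<open>autostackable G X\<close> unfolding autostackable_def by blast
  have N: "N \<subseteq> lists X"
    using nfs by (simp add: normal_forms_def)
  have "regular_language X N"
  proof (cases "X = {}")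
    case True
    then have "N = {w \<in> lists X. foldl (\<lambda>q _. q) () w \<in> UNIV}"
      using N \<open>[] \<in> N\<close> by auto
    then show ?thesis
      using regular_languageI[OF \<open>finite X\<close>, of UNIV "()" "\<lambda>q _. q" UNIV] by simp
  next
    case False
    then have "fst ` stacking_graph G X N \<phi> = nf G N ` carrier G"
      by (force simp: stacking_graph_def)
    then show ?thesis
      using synchronously_regular_fst[OF sync] image_nf_carrier[OF nfs \<open>X \<subseteq> carrier G\<close>] by simp
  qed
  then show ?thesis
    unfolding has_rational_cross_section_def
    using \<open>finite X\<close> monoid_generating_set_if_normal_forms[OF nfs \<open>X \<subseteq> carrier G\<close>] nfs
    by (auto simp: normal_forms_def)
qed

end
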